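(* Let $n\in\mathbb{N}$ and let $b,c\in\mathbb{R}$ with $b,c\notin\{0,-1,\dots,-n+1\}$. Then ${}_2F_1(-n,b;c;z)$ has all its zeros real and simple, and $(n-1)$ of them lie in (i) $(0,1)$ for $-1<c<0$ and $b>c+n-1$; the remaining zero is negative. (ii) $(1,\infty)$ for $1-n<b<2-n$ and $c<b-n+1$; the remaining zero is negative. (iii) $(-\infty,0)$ for $-1<c<0$ and $b<1-n$; the remaining zero lies in $(0,1)$.
   Context: For $n\in\mathbb{N}$ and real $b,c$ with $c\notin\{0,-1,\dots,-n+1\}$, the hypergeometric polynomial is ${}_2F_1(-n,b;c;z)=\sum_{k=0}^{n}\frac{(-n)_k(b)_k}{(c)_k}\frac{z^k}{k!}$, where $(\alpha)_0=1$ and $(\alpha)_k=\alpha(\alpha+1)\cdots(\alpha+k-1)$ for $k\ge1$. The condition $b\notin\{0,-1,\dots,-n+1\}$ ensures that it has degree exactly $n$. The assertion about reality and simplicity of the zeros is made for the parameter ranges listed in (i), (ii) and (iii).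
   Formalization: Here n ≥ 1. For n = 1 the only zero is c/b and the printed location of the remaining zero can fail (c=−1/2, b=−1/4 gives 2), so for n = 1 that location is asserted only if b>0 in (i), c<0 in (ii), b<c in (iii). *)

theory Defs
  imports Complex_Main "HOL-Computational_Algebra.Polynomial"
begin

definition hypergeom_poly :: "nat \<Rightarrow> 'a \<Rightarrow> 'a \<Rightarrow> 'a::field_char_0 poly" where
  "hypergeom_poly n b c =
     (\<Sum>k\<le>n. monom (pochhammer (- of_nat n) k * pochhammer b k / (pochhammer c k * fact k)) k)"

lemma poly_hypergeom_poly:
  "poly (hypergeom_poly n b c) z =
     (\<Sum>k\<le>n. pochhammer (- of_nat n) k * pochhammer b k / pochhammer c k * (z ^ k / fact k))"
  by (simp add: hypergeom_poly_def poly_sum poly_monom)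

definition zeros :: "complex poly \<Rightarrow> complex set" where
  "zeros p = {z. poly p z = 0}"

definition zeros_real_simple :: "complex poly \<Rightarrow> bool" where
  "zeros_real_simple p \<longleftrightarrow> p \<noteq> 0 \<and> (\<forall>z\<in>zeros p. z \<in> \<real> \<and> order z p = 1)"

end

theory Submission
  imports Defs "HOL-Computational_Algebra.Formal_Power_Series"
begin

text \<open>Write \<open>F(n, b, c)\<close> for the hypergeometric polynomial. With \<open>\<beta> = b + 1 - c - n\<close>, the derivative of
  \<open>z\<^sup>c (1 - z)\<^sup>\<beta> F(n - 1, b + 1, c + 1)\<close> is \<open>c z\<^sup>c\<^sup>-\<^sup>1 (1 - z)\<^sup>\<beta>\<^sup>-\<^sup>1 F(n, b, c)\<close>. When \<open>c > 0\<close> and \<open>\<beta> > 0\<close>,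
  both end points are zeros of the differentiated function, so Rolle's theorem gains one zero in
  \<open>(0, 1)\<close> at each step. In case (i) the last step has \<open>-1 < c < 0\<close>: the end point 0 is lost, and
  \<open>n - 1\<close> zeros in \<open>(0, 1)\<close> remain. The sign of the leading coefficient gives a negative zero.
  Case (ii) follows from (i) under \<open>z \<mapsto> 1 / z\<close>, and case (iii) under Pfaff's transformation
  \<open>z \<mapsto> z / (z - 1)\<close>. For \<open>n = 1\<close>, where these substitutions may degenerate, the only zero is
  \<open>c / b\<close>.\<close>

section \<open>Counting zeros with Rolle's theorem\<close>

text \<open>Rolle's theorem between the two largest points \<open>w < v\<close> of \<open>S\<close>
  gives one zero of \<open>f'\<close>; the induction hypothesis for the other points, with upper
  bound lowered to \<open>w\<close>, gives the rest, all below \<open>w\<close> and hence distinct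
  from it. Continuity is required only between points of \<open>S\<close>, since \<open>f\<close>
  may be singular at an end point that is not in \<open>S\<close>.\<close>

lemma rolle_card:
  fixes f f' :: "real \<Rightarrow> real"
  assumes "finite S" "S \<subseteq> {l..u}" "card S = Suc m"
    and "\<And>x. x \<in> S \<Longrightarrow> f x = 0"
    and "\<And>x y. x \<in> S \<Longrightarrow> y \<in> S \<Longrightarrow> continuous_on {x..y} f"
    and "\<And>x. l < x \<Longrightarrow> x < u \<Longrightarrow> (f has_real_derivative f' x) (at x)"
  shows "\<exists>T. finite T \<and> card T = m \<and> T \<subseteq> {l<..<u} \<and> (\<forall>x\<in>T. f' x = 0)"
  using assms
proof (induction m arbitrary: S u)
  case 0
  show ?case by (rule exI[of _ "{}"]) simp
next
  case (Suc m)
  define v where "v = Max S"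
  define S' where "S' = S - {v}"
  have ne: "S \<noteq> {}" using Suc.prems(3) by auto
  have v: "v \<in> S" using Suc.prems(1) ne by (simp add: v_def)
  have S': "finite S'" "card S' = Suc m"
    using Suc.prems v by (auto simp: S'_def)
  define w where "w = Max S'"
  have ne': "S' \<noteq> {}" using S' by auto
  have w: "w \<in> S'" using S' ne' by (simp add: w_def)
  have wS: "w \<in> S" and "w \<noteq> v" using w by (auto simp: S'_def)
  then have wv: "w < v" using Suc.prems(1) by (simp add: v_def order.strict_iff_order)
  have bnd: "l \<le> w" "v \<le> u" using Suc.prems(2) wS v by auto
  have "S' \<subseteq> {l..w}"
  proof
    fix x assume "x \<in> S'"
    then show "x \<in> {l..w}"
      using Suc.prems(2) Max_ge[OF S'(1)] by (auto simp: w_def S'_def)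
  qed
  then obtain T where T: "finite T" "card T = m" "T \<subseteq> {l<..<w}" "\<forall>x\<in>T. f' x = 0"
    using Suc.IH[of S' w] S' Suc.prems wv bnd by (force simp: S'_def)
  have "\<exists>z. w < z \<and> z < v \<and> DERIV f z :> 0"
  proof (rule Rolle[OF wv])
    show "f w = f v" using Suc.prems(4) wS v by simp
    show "continuous_on {w..v} f" using Suc.prems(5) wS v by blast
    show "f differentiable (at x)" if "w < x" "x < v" for x
      using Suc.prems(6)[of x] that bnd by (auto simp: real_differentiable_def)
  qed
  then obtain z where z: "w < z" "z < v" "DERIV f z :> 0" by blast
  have "f' z = 0"
    using Suc.prems(6)[of z] z bnd DERIV_unique by fastforce
  moreover have "z \<notin> T" using T z by auto
  ultimately show ?case
    using T z bnd wv by (intro exI[of _ "insert z T"]) auto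
qed

section \<open>Coefficients and the differentiation formula\<close>

text \<open>No bound on \<open>k\<close> is needed: \<open>pochhammer (- of_nat n) k\<close>
  vanishes for \<open>k > n\<close>.\<close>

lemma coeff_hypergeom_poly:
  "coeff (hypergeom_poly n b c) k =
     pochhammer (- of_nat n) k * pochhammer b k / (pochhammer c k * fact k)"
  by (auto simp: hypergeom_poly_def coeff_sum pochhammer_of_nat_eq_0_iff if_distrib
      sum.delta cong: if_cong)

lemma degree_hypergeom_poly_le: "degree (hypergeom_poly n b c) \<le> n"
  by (rule degree_le) (simp add: coeff_hypergeom_poly pochhammer_of_nat_eq_0_iff)

lemma poly_hypergeom_poly_0: "poly (hypergeom_poly n b c) 0 = 1"
  by (simp add: poly_0_coeff_0 coeff_hypergeom_poly)

lemma poly_hypergeom_poly_of_real: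
  "poly (hypergeom_poly n (complex_of_real b) (complex_of_real c)) (complex_of_real x) =
     complex_of_real (poly (hypergeom_poly n b c) x)"
  by (simp add: poly_hypergeom_poly flip: pochhammer_of_real)

text \<open>This is the derivative of \<open>z^c (1 - z)^\<beta> F(m, b + 1, c + 1)\<close> with the
  weight \<open>z^(c-1) (1 - z)^(\<beta>-1)\<close> divided out, where
  \<open>\<beta> = b - c - m\<close>; the linear factor is \<open>c (1 - z) - \<beta> z\<close>. As
  a polynomial identity it is checked coefficientwise.\<close>

lemma hypergeom_poly_Suc:
  fixes b c :: real
  assumes "c > -1" "c \<noteq> 0"
  shows "smult c (hypergeom_poly (Suc m) b c) =
    [:c, - (b - real m):] * hypergeom_poly m (b + 1) (c + 1) +
    [:0, 1, -1:] * pderiv (hypergeom_poly m (b + 1) (c + 1))" (is "?L = ?R")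
proof (rule poly_eqI)
  fix k
  define g where "g = (\<lambda>k. coeff (hypergeom_poly m (b + 1) (c + 1)) k)"
  have R: "coeff ?R k = (case k of 0 \<Rightarrow> c * g 0
      | Suc j \<Rightarrow> (c + 1 + real j) * g (Suc j) - (b - real m + real j) * g j)"
    by (cases k)
       (auto simp: g_def coeff_pCons coeff_pderiv algebra_simps split: nat.splits)
  show "coeff ?L k = coeff ?R k"
  proof (cases k)
    case 0
    then show ?thesis using R by (simp add: g_def coeff_hypergeom_poly)
  next
    case (Suc j)
    \<comment> \<open>The common factor of all three terms; what remains is
      \<open>-(m + 1) b = (j - m) (b + 1 + j) - (b - m + j) (j + 1)\<close>.\<close>
    define X where "X = pochhammer (- real m) j * pochhammer (b + 1) j /
      (pochhammer (c + 1) j * fact (Suc j))"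
    have pos: "pochhammer (c + 1) j > 0" "c + 1 + real j > 0"
      using assms by (auto intro!: pochhammer_pos)
    have "coeff ?L k = - (real m + 1) * b * X"
      using pos assms by (simp add: Suc X_def coeff_hypergeom_poly pochhammer_rec)
    moreover have "(c + 1 + real j) * g (Suc j) = (real j - real m) * (b + 1 + real j) * X"
    proof -
      have d: "pochhammer (c + 1) (Suc j) = (c + 1 + real j) * pochhammer (c + 1) j"
        by (simp add: pochhammer_Suc)
      show ?thesis
        unfolding g_def coeff_hypergeom_poly d X_def using pos
        by (simp add: pochhammer_Suc del: fact_Suc)
    qed
    moreover have "g j = (real j + 1) * X"
    proof -
      have j: "fact (Suc j) = (real j + 1) * fact j" "real j + 1 \<noteq> 0" by simp_all
      show ?thesis
        unfolding g_def coeff_hypergeom_poly X_def j(1) using j(2) by simp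
    qed
    ultimately show ?thesis
      unfolding R by (simp add: Suc algebra_simps)
  qed
qed

section \<open>From enough real roots to all complex zeros\<close>

text \<open>Since the degree is at most \<open>n\<close>, the \<open>n\<close> roots in
  \<open>R\<close> are all the zeros. A multiple zero would leave a cofactor of degree at most
  \<open>n - 2\<close> to vanish at the \<open>n - 1\<close> others.\<close>

lemma zeros_of_real_roots:
  fixes F :: "complex poly"
  assumes "F \<noteq> 0" "degree F \<le> n" "finite R" "card R = n"
    and root: "\<And>x. x \<in> R \<Longrightarrow> poly F (complex_of_real x) = 0"
  shows "zeros_real_simple F" "zeros F = complex_of_real ` R"
proof -
  have inj: "inj_on complex_of_real A" for A by (simp add: inj_on_def)
  have fin: "finite (zeros F)"
    using poly_roots_finite[OF assms(1)] by (simp add: zeros_def)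
  have card: "card (complex_of_real ` R) = n" using inj assms card_image by blast
  have sub: "complex_of_real ` R \<subseteq> zeros F" using root by (auto simp: zeros_def)
  have "card (zeros F) \<le> n"
    using card_poly_roots_bound[OF assms(1)] assms(2) by (simp add: zeros_def)
  then show eq: "zeros F = complex_of_real ` R"
    using card_seteq[OF fin sub] card by simp
  have "order z F = 1" if z: "z \<in> zeros F" for z
  proof (rule ccontr)
    assume "order z F \<noteq> 1"
    moreover have "order z F \<noteq> 0" using z assms(1) order_root[of F z] by (auto simp: zeros_def)
    ultimately have "[:-z, 1:]^2 dvd F" using order_divides[of z 2 F] by auto
    then obtain q where q: "F = [:-z, 1:]^2 * q" by (elim dvdE)
    then have q0: "q \<noteq> 0" using assms(1) by auto
    have "degree F = 2 + degree q"
      unfolding q using q0 by (subst degree_mult_eq) (auto simp: degree_power_eq)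
    moreover have "zeros F - {z} \<subseteq> {x. poly q x = 0}"
      using q by (auto simp: zeros_def)
    then have "card (zeros F - {z}) \<le> degree q"
      using card_mono[OF poly_roots_finite[OF q0]] card_poly_roots_bound[OF q0]
      by (meson order_trans)
    ultimately show False using assms(2) card z fin by (simp add: eq[symmetric])
  qed
  then show "zeros_real_simple F"
    using assms(1) eq by (auto simp: zeros_real_simple_def)
qed

section \<open>Real zeros for c > -1\<close>

text \<open>One Rolle step for the weighted polynomial. \<open>S\<close> holds interior zeros and
  those end points at which the weight tends to 0: 1 is always available because
  \<open>\<beta> > 0\<close>, but 0 only if \<open>c > 0\<close>. One lemma thus serves both signs
  of \<open>c\<close>.\<close>

lemma hypergeom_poly_rolle:
  fixes b c :: real
  assumes c: "c > -1" "c \<noteq> 0" and b: "b > c + real m"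
    and S: "finite S" "S \<subseteq> {0..1}" "card S = Suc k" "0 \<in> S \<Longrightarrow> c > 0"
    and root: "\<And>x. x \<in> S \<Longrightarrow> 0 < x \<Longrightarrow> x < 1 \<Longrightarrow> poly (hypergeom_poly m (b + 1) (c + 1)) x = 0"
  shows "\<exists>T. finite T \<and> card T = k \<and> T \<subseteq> {0<..<1} \<and>
    (\<forall>x\<in>T. poly (hypergeom_poly (Suc m) b c) x = 0)"
proof -
  define G where "G = hypergeom_poly m (b + 1) (c + 1)"
  define \<beta> where "\<beta> = b - c - real m"
  have \<beta>: "\<beta> > 0" using b by (simp add: \<beta>_def)
  define f where "f = (\<lambda>x. x powr c * (1 - x) powr \<beta> * poly G x)"
  define f' where "f' = (\<lambda>x. x powr (c - 1) * (1 - x) powr (\<beta> - 1) *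
    poly (smult c (hypergeom_poly (Suc m) b c)) x)"
  have "\<exists>T. finite T \<and> card T = k \<and> T \<subseteq> {0<..<1} \<and> (\<forall>x\<in>T. f' x = 0)"
  proof (rule rolle_card[OF S(1-3)])
    show "f x = 0" if "x \<in> S" for x
    proof (cases "0 < x \<and> x < 1")
      case True
      then show ?thesis using root that by (simp add: f_def G_def)
    next
      case False
      \<comment> \<open>As \<open>0 powr a = 0\<close> for every \<open>a\<close>, the values at the
        end points need no sign condition; the signs of \<open>c\<close> and \<open>\<beta>\<close>
        matter for continuity only.\<close>
      then have "x = 0 \<or> x = 1" using S(2) that by force
      then show ?thesis by (auto simp: f_def)
    qed
    show "continuous_on {x..y} f" if "x \<in> S" "y \<in> S" for x y
    proof -
      have "x = 0 \<longrightarrow> c > 0" "x \<ge> 0" "y \<le> 1" using that S by auto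
      then show ?thesis unfolding f_def using \<beta>
        by (intro continuous_intros continuous_on_powr') auto
    qed
    show "(f has_real_derivative f' x) (at x)" if x: "0 < x" "x < 1" for x
    proof -
      have 1: "((\<lambda>x. x powr c) has_real_derivative c * x powr (c - 1)) (at x)"
        by (rule has_real_derivative_powr[OF x(1)])
      have 2: "((\<lambda>x. (1 - x) powr \<beta>) has_real_derivative \<beta> * (1 - x) powr (\<beta> - 1) * (0 - 1)) (at x)"
        using x by (intro DERIV_chain2[OF has_real_derivative_powr] derivative_intros) auto
      \<comment> \<open>Splitting off one power of each factor exposes the weight common to all
        terms of the product rule.\<close>
      have *: "x powr c = x powr (c - 1) * x" "(1 - x) powr \<beta> = (1 - x) powr (\<beta> - 1) * (1 - x)"
        using x by (simp_all add: powr_diff)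
      have P: "poly (smult c (hypergeom_poly (Suc m) b c)) x =
          (c * (1 - x) - \<beta> * x) * poly G x + x * (1 - x) * poly (pderiv G) x"
        unfolding hypergeom_poly_Suc[OF c] G_def[symmetric] by (simp add: \<beta>_def algebra_simps)
      show ?thesis
        unfolding f_def
        by (rule DERIV_cong[OF DERIV_mult[OF DERIV_mult[OF 1 2] poly_DERIV]])
           (simp only: f'_def P *, simp add: algebra_simps)
    qed
  qed
  then obtain T where T: "finite T" "card T = k" "T \<subseteq> {0<..<1}" "\<forall>x\<in>T. f' x = 0"
    by blast
  \<comment> \<open>Inside \<open>(0, 1)\<close> the weight is nonzero, and so is \<open>c\<close>,
    so the polynomial itself must vanish.\<close>
  have "poly (hypergeom_poly (Suc m) b c) x = 0" if "x \<in> T" for x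
  proof -
    have "0 < x" "x < 1" "f' x = 0" using T that by auto
    then show ?thesis using c by (simp add: f'_def)
  qed
  then show ?thesis using T by blast
qed

text \<open>Both end points count: \<open>m\<close> interior zeros become \<open>m + 2\<close>
  points, hence \<open>m + 1\<close> zeros after the Rolle step. Lowering the degree by one while
  raising \<open>b\<close> and \<open>c\<close> by one preserves the hypotheses.\<close>

lemma hypergeom_poly_roots_pos:
  fixes b c :: real
  assumes "c > 0" "b > c + real m - 1"
  shows "\<exists>T. finite T \<and> card T = m \<and> T \<subseteq> {0<..<1} \<and> (\<forall>x\<in>T. poly (hypergeom_poly m b c) x = 0)"
  using assms
proof (induction m arbitrary: b c)
  case 0
  show ?case by (rule exI[of _ "{}"]) simp
next
  case (Suc m)
  obtain T where T: "finite T" "card T = m" "T \<subseteq> {0<..<1}"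
      "\<forall>x\<in>T. poly (hypergeom_poly m (b + 1) (c + 1)) x = 0"
    using Suc.IH[of "c + 1" "b + 1"] Suc.prems by auto
  have "0 \<notin> T" "1 \<notin> T" using T by auto
  then show ?case
    using T Suc.prems by (intro hypergeom_poly_rolle[where S = "insert 0 (insert 1 T)"]) auto
qed

text \<open>The value at 0 is 1. Only the first factor of \<open>pochhammer c n\<close> is negative,
  so the leading coefficient has the sign of \<open>-(-1)^n\<close> and the values tend to minus
  infinity on the left; the intermediate value theorem applies.\<close>

lemma hypergeom_poly_neg_root:
  fixes b c :: real
  assumes n: "n \<ge> 1" and b: "b > 0" and c: "-1 < c" "c < 0"
  shows "\<exists>x<0. poly (hypergeom_poly n b c) x = 0"
proof -
  define H where "H = hypergeom_poly n b c"
  obtain m where m: "n = Suc m" using n by (cases n) auto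
  have neg: "pochhammer c n < 0"
    using c by (simp add: m pochhammer_rec mult_neg_pos pochhammer_pos)
  have pos: "pochhammer b n > 0" using b by (rule pochhammer_pos)
  have cf: "coeff H n = (-1) ^ n * (pochhammer b n / pochhammer c n)"
    by (simp add: H_def coeff_hypergeom_poly pochhammer_same)
  then have "coeff H n \<noteq> 0" using neg pos by auto
  then have deg: "degree H = n"
    using degree_hypergeom_poly_le[of n b c] le_degree[of H n] by (simp add: H_def)
  \<comment> \<open>\<open>Q(x) = -H(-x)\<close> turns the behaviour of \<open>H\<close> at minus
    infinity into growth at plus infinity.\<close>
  define Q where "Q = - pcompose H [:0, -1:]"
  have "lead_coeff Q = - (pochhammer b n / pochhammer c n)"
    by (simp add: Q_def lead_coeff_comp deg cf flip: power_mult_distrib)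
  then have "lead_coeff Q > 0" using neg pos by (simp add: divide_pos_neg)
  then obtain y where y: "\<forall>x\<ge>y. poly Q x \<ge> lead_coeff Q" using poly_pinfty_gt_lc by blast
  define z where "z = - max 1 y"
  have "poly Q (max 1 y) > 0" using y \<open>lead_coeff Q > 0\<close> by (meson max.cobounded2 less_le_trans)
  then have "poly H z < 0" by (simp add: Q_def z_def poly_pcompose)
  moreover have "poly H 0 > 0" by (simp add: H_def poly_hypergeom_poly_0)
  moreover have "z < 0" by (simp add: z_def)
  ultimately show ?thesis using poly_IVT_pos[of z 0 H] by (auto simp: H_def)
qed

text \<open>Here \<open>c + 1 > 0\<close>, so the shifted polynomial has \<open>n - 1\<close> zeros
  in \<open>(0, 1)\<close>; with the end point 1 alone, the Rolle step keeps their number.\<close>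

lemma hypergeom_poly_roots_neg:
  fixes b c :: real
  assumes "n \<ge> 2" and c: "-1 < c" "c < 0" and b: "b > c + real n - 1"
  obtains T x where "finite T" "card T = n - 1" "T \<subseteq> {0<..<1}" "x < 0"
    "\<forall>t\<in>insert x T. poly (hypergeom_poly n b c) t = 0"
proof -
  obtain m where m: "n = Suc m" using assms by (cases n) auto
  obtain T where T: "finite T" "card T = m" "T \<subseteq> {0<..<1}"
      "\<forall>x\<in>T. poly (hypergeom_poly m (b + 1) (c + 1)) x = 0"
    using hypergeom_poly_roots_pos[of "c + 1" m "b + 1"] b c m by auto
  have "1 \<notin> T" using T by auto
  then have "\<exists>T. finite T \<and> card T = m \<and> T \<subseteq> {0<..<1} \<and>
      (\<forall>x\<in>T. poly (hypergeom_poly (Suc m) b c) x = 0)"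
    using T b c m by (intro hypergeom_poly_rolle[where S = "insert 1 T"]) auto
  \<comment> \<open>From \<open>n \<ge> 2\<close> and \<open>c > -1\<close> follows
    \<open>b > c + n - 1 > 0\<close>.\<close>
  moreover have "\<exists>x<0. poly (hypergeom_poly n b c) x = 0"
    using assms by (intro hypergeom_poly_neg_root) auto
  ultimately show ?thesis using m that by force
qed

section \<open>The reversal and Pfaff transformations\<close>

lemma poly_hypergeom_poly_binomial:
  "poly (hypergeom_poly n b c) z =
     (\<Sum>k\<le>n. of_nat (n choose k) * (pochhammer b k / pochhammer c k) * (- z) ^ k)"
  unfolding poly_hypergeom_poly
proof (rule sum.cong[OF refl])
  fix k
  have "(of_nat (n choose k) :: 'a) = (-1) ^ k * pochhammer (- of_nat n) k / fact k"
    by (simp add: binomial_gbinomial gbinomial_pochhammer)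
  moreover have "(-1) ^ k * (-1) ^ k = (1 :: 'a)" by (simp flip: power_mult_distrib)
  ultimately have "pochhammer (- of_nat n) k = (of_nat (n choose k) :: 'a) * (-1) ^ k * fact k"
    by simp
  then show "pochhammer (- of_nat n) k * pochhammer b k / pochhammer c k * (z ^ k / fact k) =
      of_nat (n choose k) * (pochhammer b k / pochhammer c k) * (- z) ^ k"
    by (simp add: power_minus[of z])
qed

text \<open>Summation in the reverse order, \<open>k = n - j\<close>. The signs from reflecting the
  Pochhammer symbols of \<open>b\<close> and \<open>c\<close> cancel in the quotient, and the two
  parameters exchange places.\<close>

lemma hypergeom_poly_reverse:
  fixes b c z :: "'a :: field_char_0"
  assumes b: "\<forall>k<n. b \<noteq> - of_nat k" and c: "\<forall>k<n. c \<noteq> - of_nat k" and z: "z \<noteq> 0"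
  shows "poly (hypergeom_poly n b c) z = pochhammer b n / pochhammer c n * (- z) ^ n *
    poly (hypergeom_poly n (1 - c - of_nat n) (1 - b - of_nat n)) (1 / z)"
proof -
  have nz: "pochhammer b n \<noteq> 0" "pochhammer c n \<noteq> 0"
    using b c by (auto simp: pochhammer_eq_0_iff)
  \<comment> \<open>The factors of \<open>pochhammer (1 - a - of_nat n) j\<close> are the last
    \<open>j\<close> factors of \<open>pochhammer a n\<close>, negated.\<close>
  have rev: "pochhammer (1 - a - of_nat n) j * pochhammer a (n - j) = (-1) ^ j * pochhammer a n"
    if "j \<le> n" for j and a :: 'a
    using that pochhammer_minus[of "a + of_nat n - 1" j] pochhammer_product[of "n - j" n a]
    by (simp add: algebra_simps of_nat_diff)
  have "poly (hypergeom_poly n b c) z =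
    (\<Sum>j\<le>n. of_nat (n choose (n - j)) * (pochhammer b (n - j) / pochhammer c (n - j)) * (- z) ^ (n - j))"
    unfolding poly_hypergeom_poly_binomial
    by (rule sum.reindex_bij_witness[of _ "\<lambda>j. n - j" "\<lambda>j. n - j"]) auto
  also have "\<dots> = (\<Sum>j\<le>n. pochhammer b n / pochhammer c n * (- z) ^ n *
     (of_nat (n choose j) * (pochhammer (1 - c - of_nat n) j / pochhammer (1 - b - of_nat n) j) *
       (- (1 / z)) ^ j))"
  proof (rule sum.cong[OF refl])
    fix j assume "j \<in> {..n}"
    then have j: "j \<le> n" by simp
    have pw: "(- z) ^ n * (- (1 / z)) ^ j = (- z) ^ (n - j)"
    proof -
      have "(- z) ^ n = (- z) ^ (n - j) * (- z) ^ j" using j by (simp flip: power_add)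
      moreover have "(- z) ^ j * (- (1 / z)) ^ j = 1" using z by (simp flip: power_mult_distrib)
      ultimately show ?thesis by (simp add: mult.assoc)
    qed
    have nzb: "pochhammer b (n - j) \<noteq> 0" "pochhammer (1 - b - of_nat n) j \<noteq> 0"
      using rev[OF j, of b] nz by auto
    have nzc: "pochhammer c (n - j) \<noteq> 0"
      using rev[OF j, of c] nz by auto
    have "pochhammer b (n - j) / pochhammer c (n - j) =
        pochhammer b n / pochhammer c n *
        (pochhammer (1 - c - of_nat n) j / pochhammer (1 - b - of_nat n) j)"
      using rev[OF j, of b] rev[OF j, of c] nzb nzc nz by (simp add: field_simps)
    then show "of_nat (n choose (n - j)) * (pochhammer b (n - j) / pochhammer c (n - j)) * (- z) ^ (n - j) =
        pochhammer b n / pochhammer c n * (- z) ^ n *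
        (of_nat (n choose j) * (pochhammer (1 - c - of_nat n) j / pochhammer (1 - b - of_nat n) j) *
         (- (1 / z)) ^ j)"
      by (simp add: binomial_symmetric[OF j, symmetric] flip: pw)
  qed
  finally show ?thesis by (simp add: poly_hypergeom_poly_binomial sum_distrib_left)
qed

text \<open>The prefactor clears the denominators and leaves \<open>(1 - z)^(n-k)\<close> in the
  term of index \<open>k\<close>. Expanding it and collecting powers of \<open>z\<close> makes each
  coefficient a Chu-Vandermonde sum.\<close>

lemma hypergeom_poly_pfaff:
  fixes b c z :: "'a :: field_char_0"
  assumes c: "\<forall>k<n. c \<noteq> - of_nat k" and z: "z \<noteq> 1"
  shows "poly (hypergeom_poly n b c) z =
    (1 - z) ^ n * poly (hypergeom_poly n (c - b) c) (z / (z - 1))"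
proof -
  define A where "A = (\<lambda>k. pochhammer (c - b) k / pochhammer c k)"
  have "(1 - z) ^ n * poly (hypergeom_poly n (c - b) c) (z / (z - 1)) =
    (\<Sum>k\<le>n. \<Sum>j\<le>n - k. of_nat (n choose k) * A k * z ^ k *
        (of_nat ((n - k) choose j) * (- z) ^ j))"
    unfolding poly_hypergeom_poly_binomial sum_distrib_left
  proof (rule sum.cong[OF refl])
    fix k assume "k \<in> {..n}"
    then have "(1 - z) ^ n = (1 - z) ^ k * (1 - z) ^ (n - k)"
      by (simp flip: power_add)
    moreover have "(1 - z) * (- (z / (z - 1))) = z"
      using z by (simp add: field_simps)
    then have "(1 - z) ^ k * (- (z / (z - 1))) ^ k = z ^ k"
      by (simp only: flip: power_mult_distrib)
    ultimately have "(1 - z) ^ n * (of_nat (n choose k) * A k * (- (z / (z - 1))) ^ k) =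
        of_nat (n choose k) * A k * z ^ k * (1 - z) ^ (n - k)"
      by (simp add: ac_simps)
    also have "(1 - z) ^ (n - k) = (\<Sum>j\<le>n - k. of_nat ((n - k) choose j) * (- z) ^ j)"
      using binomial_ring[of "- z" 1 "n - k"] by simp
    finally show "(1 - z) ^ n * (of_nat (n choose k) *
        (pochhammer (c - b) k / pochhammer c k) * (- (z / (z - 1))) ^ k) =
        (\<Sum>j\<le>n - k. of_nat (n choose k) * A k * z ^ k * (of_nat ((n - k) choose j) * (- z) ^ j))"
      by (simp add: A_def sum_distrib_left)
  qed
  \<comment> \<open>Regrouping by the total power \<open>m = k + j\<close>.\<close>
  also have "\<dots> = (\<Sum>m\<le>n. \<Sum>k\<le>m. of_nat (n choose k) * A k * z ^ k *
        (of_nat ((n - k) choose (m - k)) * (- z) ^ (m - k)))"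
  proof -
    have *: "Sigma {..n} (\<lambda>k. {..n - k}) = {(i, j). i + j \<le> n}" by auto
    show ?thesis
      by (subst sum.Sigma) (simp_all add: * sum.triangle_reindex_eq)
  qed
  also have "\<dots> = poly (hypergeom_poly n b c) z"
    unfolding poly_hypergeom_poly_binomial
  proof (rule sum.cong[OF refl])
    fix m assume "m \<in> {..n}"
    then have m: "m \<le> n" by simp
    have "(\<Sum>k\<le>m. of_nat (n choose k) * A k * z ^ k *
          (of_nat ((n - k) choose (m - k)) * (- z) ^ (m - k))) =
      (\<Sum>k\<le>m. of_nat (n choose m) * (- z) ^ m *
          (pochhammer (c - b) k * pochhammer (- of_nat m) k / (of_nat (fact k) * pochhammer c k)))"
    proof (rule sum.cong[OF refl])
      fix k assume "k \<in> {..m}"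
      then have k: "k \<le> m" by simp
      have 1: "(of_nat (n choose k) * of_nat ((n - k) choose (m - k)) :: 'a) =
          of_nat (n choose m) * of_nat (m choose k)"
        using choose_mult[OF k m] by (simp flip: of_nat_mult)
      have 2: "(of_nat (m choose k) :: 'a) = (-1) ^ k * (pochhammer (- of_nat m) k / fact k)"
        by (simp add: binomial_gbinomial gbinomial_pochhammer)
      have "of_nat (n choose k) * A k * z ^ k *
          (of_nat ((n - k) choose (m - k)) * (- z) ^ (m - k)) =
          (of_nat (n choose k) * of_nat ((n - k) choose (m - k))) * (A k * z ^ k * (- z) ^ (m - k))"
        by (simp only: ac_simps)
      then have "of_nat (n choose k) * A k * z ^ k *
          (of_nat ((n - k) choose (m - k)) * (- z) ^ (m - k)) =
          of_nat (n choose m) * ((-1) ^ k * (pochhammer (- of_nat m) k / fact k)) *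
          (A k * z ^ k * (- z) ^ (m - k))"
        by (simp only: 1 2)
      moreover have "(- z) ^ m = (-1) ^ k * z ^ k * (- z) ^ (m - k)"
        using k by (simp flip: power_minus power_add)
      ultimately show "of_nat (n choose k) * A k * z ^ k *
          (of_nat ((n - k) choose (m - k)) * (- z) ^ (m - k)) =
          of_nat (n choose m) * (- z) ^ m *
          (pochhammer (c - b) k * pochhammer (- of_nat m) k / (of_nat (fact k) * pochhammer c k))"
        by (simp add: A_def ac_simps)
    qed
    \<comment> \<open>Chu-Vandermonde with upper parameter \<open>c - b\<close>, whose complement
      \<open>c - (c - b)\<close> is \<open>b\<close>.\<close>
    also have "\<dots> = of_nat (n choose m) * (- z) ^ m * (pochhammer b m / pochhammer c m)"
      using Vandermonde_pochhammer[of m c "c - b"] c m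
      unfolding sum_distrib_left[symmetric] atMost_atLeast0 by auto
    finally show "(\<Sum>k\<le>m. of_nat (n choose k) * A k * z ^ k *
          (of_nat ((n - k) choose (m - k)) * (- z) ^ (m - k))) =
       of_nat (n choose m) * (pochhammer b m / pochhammer c m) * (- z) ^ m"
      by (simp add: ac_simps)
  qed
  finally show ?thesis ..
qed

section \<open>Location of the zeros in the three cases\<close>

text \<open>The \<open>n - 1\<close> roots in \<open>T\<close> and the root \<open>x\<close> outside
  \<open>I\<close> are \<open>n\<close> distinct real roots, hence all complex zeros.\<close>

lemma zeros_hypergeom_poly_of_real_roots:
  assumes "n \<ge> 1" "finite T" "card T = n - 1" "T \<subseteq> I" "x \<notin> I"
    and root: "\<forall>t\<in>insert x T. poly (hypergeom_poly n b c) t = 0"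
    and F: "F = hypergeom_poly n (complex_of_real b) (complex_of_real c)"
  shows "zeros_real_simple F"
    and "card (zeros F \<inter> complex_of_real ` I) = n - 1"
    and "zeros F - complex_of_real ` I = {complex_of_real x}"
proof -
  have x: "x \<notin> T" using assms by auto
  have "F \<noteq> 0" using poly_hypergeom_poly_0[of n "complex_of_real b" "complex_of_real c"] F by force
  moreover have "degree F \<le> n" unfolding F by (rule degree_hypergeom_poly_le)
  moreover have "card (insert x T) = n" using assms x by simp
  moreover have "poly F (complex_of_real t) = 0" if "t \<in> insert x T" for t
    using root that by (simp only: F poly_hypergeom_poly_of_real) simp
  ultimately have simp: "zeros_real_simple F" and eq: "zeros F = complex_of_real ` insert x T"
    using zeros_of_real_roots[of F n "insert x T"] assms(2) by blast+
  show "zeros_real_simple F" by (fact simp)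
  have "zeros F \<inter> complex_of_real ` I = complex_of_real ` T"
    unfolding eq using assms by auto
  then show "card (zeros F \<inter> complex_of_real ` I) = n - 1"
    using assms(3) by (simp add: card_image inj_on_def)
  show "zeros F - complex_of_real ` I = {complex_of_real x}"
    unfolding eq using assms by auto
qed

text \<open>The guards on the position of the last zero concern \<open>n = 1\<close> only: the zero
  is then \<open>c / b\<close>, and the parameter ranges alone do not fix its position. In (i), for
  instance, \<open>c < b < 0\<close> gives \<open>c / b > 1\<close>.\<close>

theorem theorem7:
  fixes n :: nat and b c :: real and F :: "complex poly"
  assumes n: "n \<ge> 1"
    and b: "\<forall>k<n. b \<noteq> - real k"
    and c: "\<forall>k<n. c \<noteq> - real k"
    and F: "F = hypergeom_poly n (complex_of_real b) (complex_of_real c)"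
  shows
    "(-1 < c \<and> c < 0 \<and> b > c + real n - 1 \<longrightarrow>
        zeros_real_simple F \<and>
        card (zeros F \<inter> complex_of_real ` {0<..<1}) = n - 1 \<and>
        (\<exists>x. zeros F - complex_of_real ` {0<..<1} = {complex_of_real x} \<and>
             (n \<ge> 2 \<or> b > 0 \<longrightarrow> x < 0))) \<and>
     (1 - real n < b \<and> b < 2 - real n \<and> c < b - real n + 1 \<longrightarrow>
        zeros_real_simple F \<and>
        card (zeros F \<inter> complex_of_real ` {1<..}) = n - 1 \<and>
        (\<exists>x. zeros F - complex_of_real ` {1<..} = {complex_of_real x} \<and>
             (n \<ge> 2 \<or> c < 0 \<longrightarrow> x < 0))) \<and>
     (-1 < c \<and> c < 0 \<and> b < 1 - real n \<longrightarrow>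
        zeros_real_simple F \<and>
        card (zeros F \<inter> complex_of_real ` {..<0}) = n - 1 \<and>
        (\<exists>x. zeros F - complex_of_real ` {..<0} = {complex_of_real x} \<and>
             (n \<ge> 2 \<or> b < c \<longrightarrow> 0 < x \<and> x < 1)))"
proof (cases "n = 1")
  case True
  have nz: "b \<noteq> 0" "c \<noteq> 0" using b c True by force+
  have root: "\<forall>t\<in>insert (c / b) {}. poly (hypergeom_poly n b c) t = 0"
    using nz by (simp add: True poly_hypergeom_poly_binomial)
  have fin: "zeros_real_simple F" "card (zeros F \<inter> complex_of_real ` I) = n - 1"
      "zeros F - complex_of_real ` I = {complex_of_real (c / b)}" if "c / b \<notin> I" for I
    using zeros_hypergeom_poly_of_real_roots[OF n _ _ _ that root F] True by simp_all
  show ?thesis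
  proof (intro conjI impI; elim conjE)
    assume "-1 < c" "c < 0" "b > c + real n - 1"
    then have "c / b \<notin> {0<..<1}" "b > 0 \<Longrightarrow> c / b < 0"
      using nz True by (cases "b > 0"; auto simp: field_simps)+
    then show "zeros_real_simple F" "card (zeros F \<inter> complex_of_real ` {0<..<1}) = n - 1"
      "\<exists>x. zeros F - complex_of_real ` {0<..<1} = {complex_of_real x} \<and> (n \<ge> 2 \<or> b > 0 \<longrightarrow> x < 0)"
      using fin[of "{0<..<1}"] True by (blast, blast, intro exI[of _ "c / b"], simp)
  next
    assume "1 - real n < b" "b < 2 - real n" "c < b - real n + 1"
    then have "c / b \<notin> {1<..}" "c < 0 \<Longrightarrow> c / b < 0"
      using nz True by (auto simp: field_simps)
    then show "zeros_real_simple F" "card (zeros F \<inter> complex_of_real ` {1<..}) = n - 1"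
      "\<exists>x. zeros F - complex_of_real ` {1<..} = {complex_of_real x} \<and> (n \<ge> 2 \<or> c < 0 \<longrightarrow> x < 0)"
      using fin[of "{1<..}"] True by (blast, blast, intro exI[of _ "c / b"], simp)
  next
    assume "-1 < c" "c < 0" "b < 1 - real n"
    then have "c / b \<notin> {..<0}" "b < c \<Longrightarrow> 0 < c / b \<and> c / b < 1"
      using nz True by (auto simp: field_simps)
    then show "zeros_real_simple F" "card (zeros F \<inter> complex_of_real ` {..<0}) = n - 1"
      "\<exists>x. zeros F - complex_of_real ` {..<0} = {complex_of_real x} \<and> (n \<ge> 2 \<or> b < c \<longrightarrow> 0 < x \<and> x < 1)"
      using fin[of "{..<0}"] True by (blast, blast, intro exI[of _ "c / b"], simp)
  qed
next
  case False
  then have n2: "n \<ge> 2" using n by simp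
  note fin = zeros_hypergeom_poly_of_real_roots[OF n _ _ _ _ _ F]
  show ?thesis
  proof (intro conjI impI; elim conjE)
    assume "-1 < c" "c < 0" "b > c + real n - 1"
    then obtain T x where *: "finite T" "card T = n - 1" "T \<subseteq> {0<..<1}" "x < 0"
        "\<forall>t\<in>insert x T. poly (hypergeom_poly n b c) t = 0"
      by (rule hypergeom_poly_roots_neg[OF n2])
    then have "x \<notin> {0<..<1}" by simp
    from fin[OF *(1-3) this *(5)] *(4)
    show "zeros_real_simple F" "card (zeros F \<inter> complex_of_real ` {0<..<1}) = n - 1"
      "\<exists>x. zeros F - complex_of_real ` {0<..<1} = {complex_of_real x} \<and> (n \<ge> 2 \<or> b > 0 \<longrightarrow> x < 0)"
      by blast+
  next
    assume "1 - real n < b" "b < 2 - real n" "c < b - real n + 1"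
    \<comment> \<open>The hypotheses of (i) for the reversed parameters \<open>1 - c - n\<close> and
      \<open>1 - b - n\<close>. Inversion maps \<open>(0, 1)\<close> into
      \<open>(1, \<infinity>)\<close> and keeps the negative zero negative.\<close>
    then have "-1 < 1 - b - real n" "1 - b - real n < 0"
        "1 - c - real n > 1 - b - real n + real n - 1"
      by auto
    then obtain T x where *: "finite T" "card T = n - 1" "T \<subseteq> {0<..<1}" "x < 0"
        "\<forall>t\<in>insert x T. poly (hypergeom_poly n (1 - c - real n) (1 - b - real n)) t = 0"
      by (rule hypergeom_poly_roots_neg[OF n2])
    have root: "\<forall>t\<in>insert (inverse x) (inverse ` T). poly (hypergeom_poly n b c) t = 0"
    proof
      fix t assume "t \<in> insert (inverse x) (inverse ` T)"
      then have "1 / t \<in> insert x T" "t \<noteq> 0" using * by (auto simp: divide_inverse)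
      then show "poly (hypergeom_poly n b c) t = 0"
        using hypergeom_poly_reverse[OF b c] bspec[OF *(5)] by simp
    qed
    have card: "card (inverse ` T) = n - 1" using * by (simp add: card_image inj_on_def)
    have sub: "inverse ` T \<subseteq> {1<..}" using *(3) by (auto simp: one_less_inverse)
    have x: "inverse x \<notin> {1<..}" "inverse x < 0" using *(4) by (auto simp: field_simps)
    from fin[OF _ card sub x(1) root] *(1) x(2-)
    show "zeros_real_simple F" "card (zeros F \<inter> complex_of_real ` {1<..}) = n - 1"
      "\<exists>x. zeros F - complex_of_real ` {1<..} = {complex_of_real x} \<and> (n \<ge> 2 \<or> c < 0 \<longrightarrow> x < 0)"
      by blast+
  next
    assume "-1 < c" "c < 0" "b < 1 - real n"
    \<comment> \<open>The hypotheses of (i) with \<open>c - b\<close> in place of \<open>b\<close>,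
      as in Pfaff's transformation.\<close>
    then have "-1 < c" "c < 0" "c - b > c + real n - 1" by auto
    then obtain T x where *: "finite T" "card T = n - 1" "T \<subseteq> {0<..<1}" "x < 0"
        "\<forall>t\<in>insert x T. poly (hypergeom_poly n (c - b) c) t = 0"
      by (rule hypergeom_poly_roots_neg[OF n2])
    \<comment> \<open>An involution away from 1 that exchanges \<open>(0, 1)\<close> and the
      negative half-line.\<close>
    define \<phi> where "\<phi> = (\<lambda>w::real. w / (w - 1))"
    have inv: "\<phi> (\<phi> w) = w" "\<phi> w \<noteq> 1" if "w \<noteq> 1" for w
      using that by (simp_all add: \<phi>_def field_simps)
    have ne: "w \<noteq> 1" if "w \<in> insert x T" for w using * that by auto
    have root: "\<forall>t\<in>insert (\<phi> x) (\<phi> ` T). poly (hypergeom_poly n b c) t = 0"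
    proof
      fix t assume "t \<in> insert (\<phi> x) (\<phi> ` T)"
      then have "\<phi> t \<in> insert x T" "t \<noteq> 1" using inv ne by auto
      then show "poly (hypergeom_poly n b c) t = 0"
        using hypergeom_poly_pfaff[OF c, of t b] bspec[OF *(5)] by (auto simp: \<phi>_def)
    qed
    have "inj_on \<phi> T" using inv(1) ne by (intro inj_on_inverseI[of _ \<phi>]) auto
    then have card: "card (\<phi> ` T) = n - 1" using * by (simp add: card_image)
    have sub: "\<phi> ` T \<subseteq> {..<0}" using *(3) by (auto simp: \<phi>_def divide_pos_neg)
    have x: "\<phi> x \<notin> {..<0}" "0 < \<phi> x" "\<phi> x < 1"
      using *(4) by (auto simp: \<phi>_def field_simps)
    from fin[OF _ card sub x(1) root] *(1) x(2-)
    show "zeros_real_simple F" "card (zeros F \<inter> complex_of_real ` {..<0}) = n - 1"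
      "\<exists>x. zeros F - complex_of_real ` {..<0} = {complex_of_real x} \<and> (n \<ge> 2 \<or> b < c \<longrightarrow> 0 < x \<and> x < 1)"
      by blast+
  qed
qed

end
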